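(* Let $\mathfrak{g}$ be a finite dimensional reductive Lie algebra over $\mathbb{C}$ with an invariant non-degenerate symmetric bilinear form $\langle\,,\,\rangle$ and associated Casimir element $\Omega\in[\mathfrak{g}^{\otimes2}]^{\mathfrak{g}}$. Let $\lambda_1,\lambda_2$ be dominant integral weights, $\vec p=(p_1,p_2)\in\mathbb{C}^2$, and $P,Q\in\mathbb{C}[t]$, and put $w_1=P(p_1)$, $w_2=P(p_2)$, $z_1=Q(p_1)$, $z_2=Q(p_2)$. Then for any $v$ in the $\mathfrak{g}$-isotypic component of highest weight $\mu$ of $V(\lambda_1)\otimes V(\lambda_2)$, the action of $\Omega(P,Q)$ on the evaluation module $\vec V_{\vec p}(\lambda_1,\lambda_2)$ is given by $$\Omega(P,Q)(v)=\Big(w_1z_1C_{\lambda_1}+w_2z_2C_{\lambda_2}+\frac{w_1z_2+w_2z_1}{2}\,(C_\mu-C_{\lambda_1}-C_{\lambda_2})\Big)v,$$ where $C_\nu$ denotes the scalar by which $\Omega$ acts on $V(\nu)$.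
   Context: $\mathfrak{g}[t]=\mathfrak{g}\otimes\mathbb{C}[t]$ is the Lie algebra with bracket $[x(P),y(Q)]=[x,y](PQ)$, where $x(P):=x\otimes P$; $\mathfrak{g}$ is identified with $\mathfrak{g}\otimes1$. $V(\lambda)$ is the finite dimensional irreducible $\mathfrak{g}$-module of highest weight $\lambda$. With $\{e_i\}$ a basis of $\mathfrak{g}$ and $\{e^i\}$ the dual basis under $\langle\,,\,\rangle$, $\Omega:=\sum_ie_i\otimes e^i$, acting on a $\mathfrak{g}$-module as $\sum_ie_ie^i$, and $\Omega(P,Q):=\sum_ie_i(P)\,e^i(Q)\in U(\mathfrak{g}[t])$. The evaluation module $\vec V_{\vec p}(\lambda_1,\lambda_2)$ is $V(\lambda_1)\otimes V(\lambda_2)$ with $\mathfrak{g}[t]$-action $$x(P)\cdot(v_1\otimes v_2)=P(p_1)\,x\cdot v_1\otimes v_2+P(p_2)\,v_1\otimes x\cdot v_2 .$$ *)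

theory Defs
  imports
    Complex_Main
    "HOL-Library.Poly_Mapping"
    "HOL-Computational_Algebra.Polynomial"
begin

section \<open>Complex vector spaces\<close>

class complex_vector = ab_group_add +
  fixes scaleC :: "complex \<Rightarrow> 'a \<Rightarrow> 'a"  (infixr \<open>*\<^sub>C\<close> 75)
  assumes scaleC_add_right: "c *\<^sub>C (x + y) = c *\<^sub>C x + c *\<^sub>C y"
    and scaleC_add_left: "(c + d) *\<^sub>C x = c *\<^sub>C x + d *\<^sub>C x"
    and scaleC_scaleC: "c *\<^sub>C (d *\<^sub>C x) = (c * d) *\<^sub>C x"
    and scaleC_one: "1 *\<^sub>C x = x"

abbreviation clinear :: "('a::complex_vector \<Rightarrow> 'b::complex_vector) \<Rightarrow> bool"
  where "clinear \<equiv> Vector_Spaces.linear scaleC scaleC"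

global_interpretation cvec: vector_space "scaleC :: complex \<Rightarrow> 'a \<Rightarrow> 'a::complex_vector"
  defines cdependent = cvec.dependent
    and csubspace = cvec.subspace
    and cspan = cvec.span
  by unfold_locales (auto simp: scaleC_add_right scaleC_add_left scaleC_scaleC scaleC_one)

definition cbilinear :: "('a::complex_vector \<Rightarrow> 'b::complex_vector \<Rightarrow> 'c::complex_vector) \<Rightarrow> bool"
  where "cbilinear f \<longleftrightarrow> (\<forall>x. clinear (f x)) \<and> (\<forall>y. clinear (\<lambda>x. f x y))"

definition cbasis :: "'a::complex_vector set \<Rightarrow> bool"
  where "cbasis B \<longleftrightarrow> \<not> cdependent B \<and> cspan B = UNIV"

definition finite_dimensional :: "'a::complex_vector itself \<Rightarrow> bool"
  where "finite_dimensional _ \<longleftrightarrow> (\<exists>S :: 'a set. finite S \<and> cspan S = UNIV)"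

lemma clinearI:
  assumes "\<And>x y. f (x + y) = f x + f y" "\<And>c x. f (c *\<^sub>C x) = c *\<^sub>C f x"
  shows "clinear f"
  by (rule Vector_Spaces.linear.intro)
    (use assms in \<open>auto intro!: cvec.vector_space_axioms simp: module_hom_axioms_def module_hom_def
      cvec.module_axioms\<close>)

lemma clinear_add: "clinear f \<Longrightarrow> f (x + y) = f x + f y"
  and clinear_scale: "clinear f \<Longrightarrow> f (c *\<^sub>C x) = c *\<^sub>C f x"
  and clinear_0: "clinear f \<Longrightarrow> f 0 = 0"
  and clinear_diff: "clinear f \<Longrightarrow> f (x - y) = f x - f y"
  and clinear_sum: "clinear f \<Longrightarrow> f (sum g A) = (\<Sum>a\<in>A. f (g a))"
  unfolding Vector_Spaces.linear_def
  by (blast dest: module_hom.add module_hom.scale module_hom.zero module_hom.diff module_hom.sum)+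

lemma clinear_span_zero:
  assumes "clinear f" "\<And>x. x \<in> S \<Longrightarrow> f x = 0" "x \<in> cspan S"
  shows "f x = 0"
  using assms(3)
  by (induction rule: cvec.span_induct_alt)
    (simp_all add: clinear_0 clinear_add clinear_scale assms)

lemma cbilinearI:
  assumes "\<And>x x' y. f (x + x') y = f x y + f x' y" "\<And>c x y. f (c *\<^sub>C x) y = c *\<^sub>C f x y"
    "\<And>x y y'. f x (y + y') = f x y + f x y'" "\<And>c x y. f x (c *\<^sub>C y) = c *\<^sub>C f x y"
  shows "cbilinear f"
  using assms by (auto simp: cbilinear_def intro!: clinearI)

lemma cbilinearD:
  assumes "cbilinear f"
  shows "f (x + x') y = f x y + f x' y" "f (c *\<^sub>C x) y = c *\<^sub>C f x y"
    "f x (y + y') = f x y + f x y'" "f x (c *\<^sub>C y) = c *\<^sub>C f x y"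
    "f 0 y = 0" "f x 0 = 0"
  using assms clinear_add[of "f x"] clinear_add[of "\<lambda>x. f x y"]
    clinear_scale[of "f x"] clinear_scale[of "\<lambda>x. f x y"] clinear_0[of "f x"] clinear_0[of "\<lambda>x. f x y"]
  unfolding cbilinear_def by auto

class complex_comm_algebra = complex_vector + comm_ring_1 +
  assumes scaleC_mult_left: "(c *\<^sub>C x) * y = c *\<^sub>C (x * y)"

instantiation complex :: complex_comm_algebra
begin
definition scaleC_complex :: "complex \<Rightarrow> complex \<Rightarrow> complex"
  where "scaleC_complex c x = c * x"
instance by standard (auto simp: scaleC_complex_def algebra_simps)
end

lemma scaleC_0_right: "c *\<^sub>C (0 :: 'a::complex_vector) = 0"
  by (rule cvec.scale_zero_right)

instantiation poly :: (complex_vector) complex_vector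
begin
definition scaleC_poly :: "complex \<Rightarrow> 'a poly \<Rightarrow> 'a poly"
  where "scaleC_poly c p = map_poly (scaleC c) p"
instance
  by standard
    (auto simp: scaleC_poly_def poly_eq_iff coeff_map_poly scaleC_0_right
      scaleC_add_right scaleC_add_left scaleC_scaleC scaleC_one)
end

instance poly :: (complex_comm_algebra) complex_comm_algebra
proof
  fix c :: complex and p q :: "'a poly"
  show "(c *\<^sub>C p) * q = c *\<^sub>C (p * q)"
    by (simp add: poly_eq_iff coeff_mult scaleC_poly_def coeff_map_poly scaleC_0_right
        scaleC_mult_left cvec.scale_sum_right)
qed

text \<open>\<open>'k \<Rightarrow>\<^sub>0 complex\<close> is the free vector space on \<open>'k\<close>.\<close>

instantiation poly_mapping :: (type, complex_vector) complex_vector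
begin
definition scaleC_poly_mapping :: "complex \<Rightarrow> ('a \<Rightarrow>\<^sub>0 'b) \<Rightarrow> ('a \<Rightarrow>\<^sub>0 'b)"
  where "scaleC_poly_mapping c p = Poly_Mapping.map (scaleC c) p"
lemma lookup_scaleC [simp]:
  "Poly_Mapping.lookup (c *\<^sub>C p) k = c *\<^sub>C Poly_Mapping.lookup (p :: 'a \<Rightarrow>\<^sub>0 'b) k"
  by (simp add: scaleC_poly_mapping_def Poly_Mapping.map.rep_eq when_def scaleC_0_right)
instance
  by standard
    (auto intro!: poly_mapping_eqI simp: lookup_add
      scaleC_add_right scaleC_add_left scaleC_scaleC scaleC_one)
end

definition free_lift :: "('k \<Rightarrow> 'v::complex_vector) \<Rightarrow> ('k \<Rightarrow>\<^sub>0 complex) \<Rightarrow> 'v"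
  where "free_lift f p = (\<Sum>k\<in>Poly_Mapping.keys p. Poly_Mapping.lookup p k *\<^sub>C f k)"

lemma free_lift_superset:
  assumes "finite A" "Poly_Mapping.keys p \<subseteq> A"
  shows "free_lift f p = (\<Sum>k\<in>A. Poly_Mapping.lookup p k *\<^sub>C f k)"
  unfolding free_lift_def using assms by (intro sum.mono_neutral_left) (auto simp: in_keys_iff)

lemma free_lift_single [simp]: "free_lift f (Poly_Mapping.single k c) = c *\<^sub>C f k"
  by (simp add: free_lift_def)

lemma clinear_free_lift: "clinear (free_lift f)"
proof (rule clinearI)
  fix p q :: "'a \<Rightarrow>\<^sub>0 complex" and c :: complex
  let ?A = "Poly_Mapping.keys p \<union> Poly_Mapping.keys q"
  have "finite ?A" by simp
  then have "free_lift f (p + q) = (\<Sum>k\<in>?A. Poly_Mapping.lookup (p + q) k *\<^sub>C f k)"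
    "free_lift f p = (\<Sum>k\<in>?A. Poly_Mapping.lookup p k *\<^sub>C f k)"
    "free_lift f q = (\<Sum>k\<in>?A. Poly_Mapping.lookup q k *\<^sub>C f k)"
    using keys_add[of p q] by (auto intro!: free_lift_superset)
  then show "free_lift f (p + q) = free_lift f p + free_lift f q"
    by (simp add: lookup_add scaleC_add_left sum.distrib)
  have "free_lift f (c *\<^sub>C p) = (\<Sum>k\<in>Poly_Mapping.keys p. Poly_Mapping.lookup (c *\<^sub>C p) k *\<^sub>C f k)"
    by (rule free_lift_superset) (auto simp: in_keys_iff scaleC_0_right)
  then show "free_lift f (c *\<^sub>C p) = c *\<^sub>C free_lift f p"
    by (simp add: free_lift_def cvec.scale_sum_right scaleC_complex_def scaleC_scaleC)
qed

lemma free_induct: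
  assumes "\<And>k. P (Poly_Mapping.single k 1)" "\<And>p q. P p \<Longrightarrow> P q \<Longrightarrow> P (p + q)"
    "\<And>c p. P p \<Longrightarrow> P (c *\<^sub>C p)" "P 0"
  shows "P (p :: 'k \<Rightarrow>\<^sub>0 complex)"
proof -
  have "p = free_lift (\<lambda>k. Poly_Mapping.single k 1) p"
    by (rule poly_mapping_eqI)
      (auto simp: free_lift_def lookup_sum lookup_single scaleC_complex_def when_def in_keys_iff
        if_distrib cong: if_cong)
  moreover have "P (\<Sum>k\<in>A. f k *\<^sub>C Poly_Mapping.single k 1)" for A :: "'k set" and f
    by (induction A rule: infinite_finite_induct) (use assms in auto)
  ultimately show ?thesis by (metis free_lift_def)
qed


section \<open>Tensor products over the complex numbers\<close>

definition tensor_relations :: "('a::complex_vector \<times> 'b::complex_vector \<Rightarrow>\<^sub>0 complex) set"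
  where "tensor_relations =
      {Poly_Mapping.single (a + a', b) 1 - Poly_Mapping.single (a, b) 1 - Poly_Mapping.single (a', b) 1 |a a' b. True}
    \<union> {Poly_Mapping.single (a, b + b') 1 - Poly_Mapping.single (a, b) 1 - Poly_Mapping.single (a, b') 1 |a b b'. True}
    \<union> {Poly_Mapping.single (c *\<^sub>C a, b) 1 - c *\<^sub>C Poly_Mapping.single (a, b) 1 |c a b. True}
    \<union> {Poly_Mapping.single (a, c *\<^sub>C b) 1 - c *\<^sub>C Poly_Mapping.single (a, b) 1 |c a b. True}"

definition tensor_rel ::
  "('a::complex_vector \<times> 'b::complex_vector \<Rightarrow>\<^sub>0 complex) \<Rightarrow> ('a \<times> 'b \<Rightarrow>\<^sub>0 complex) \<Rightarrow> bool"
  where "tensor_rel p q \<longleftrightarrow> p - q \<in> cspan tensor_relations"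

lemma equivp_span_diff: "equivp (\<lambda>p q. p - q \<in> cspan S)"
proof (rule equivpI)
  show "reflp (\<lambda>p q. p - q \<in> cspan S)"
    by (auto simp: reflp_def cvec.span_zero)
  show "symp (\<lambda>p q. p - q \<in> cspan S)"
    by (auto simp: symp_def dest: cvec.span_neg)
  show "transp (\<lambda>p q. p - q \<in> cspan S)"
  proof (rule transpI)
    fix p q r assume "p - q \<in> cspan S" "q - r \<in> cspan S"
    then have "(p - q) + (q - r) \<in> cspan S" by (rule cvec.span_add)
    then show "p - r \<in> cspan S" by simp
  qed
qed

lemma span_diff_add: "p - p' \<in> cspan S \<Longrightarrow> q - q' \<in> cspan S \<Longrightarrow> (p + q) - (p' + q') \<in> cspan S"
  using cvec.span_add[of "p - p'" S "q - q'"] by (simp add: algebra_simps)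

lemma span_diff_diff: "p - p' \<in> cspan S \<Longrightarrow> q - q' \<in> cspan S \<Longrightarrow> (p - q) - (p' - q') \<in> cspan S"
  using cvec.span_diff[of "p - p'" S "q - q'"] by (simp add: algebra_simps)

lemma span_diff_minus: "p - p' \<in> cspan S \<Longrightarrow> (- p) - (- p') \<in> cspan S"
  using cvec.span_neg[of "p - p'" S] by (simp add: algebra_simps)

lemma span_diff_scale: "p - p' \<in> cspan S \<Longrightarrow> c *\<^sub>C p - c *\<^sub>C p' \<in> cspan S"
  using cvec.span_scale[of "p - p'" S c] by (simp add: cvec.scale_right_diff_distrib)

quotient_type (overloaded) ('a, 'b) tensor =
  "'a::complex_vector \<times> 'b::complex_vector \<Rightarrow>\<^sub>0 complex" / tensor_rel
  morphisms rep_tensor abs_tensor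
  unfolding tensor_rel_def[abs_def] by (rule equivp_span_diff)

instantiation tensor :: (complex_vector, complex_vector) complex_vector
begin

lift_definition zero_tensor :: "('a, 'b) tensor" is 0 .
lift_definition plus_tensor :: "('a, 'b) tensor \<Rightarrow> ('a, 'b) tensor \<Rightarrow> ('a, 'b) tensor" is "(+)"
  unfolding tensor_rel_def by (rule span_diff_add)
lift_definition minus_tensor :: "('a, 'b) tensor \<Rightarrow> ('a, 'b) tensor \<Rightarrow> ('a, 'b) tensor" is "(-)"
  unfolding tensor_rel_def by (rule span_diff_diff)
lift_definition uminus_tensor :: "('a, 'b) tensor \<Rightarrow> ('a, 'b) tensor" is uminus
  unfolding tensor_rel_def by (rule span_diff_minus)
lift_definition scaleC_tensor :: "complex \<Rightarrow> ('a, 'b) tensor \<Rightarrow> ('a, 'b) tensor" is scaleC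
  unfolding tensor_rel_def by (rule span_diff_scale)

instance
  by standard
    (transfer, simp add: tensor_rel_def cvec.span_zero algebra_simps
      scaleC_add_right scaleC_add_left scaleC_scaleC scaleC_one)+

end

lift_definition tensor :: "'a::complex_vector \<Rightarrow> 'b::complex_vector \<Rightarrow> ('a, 'b) tensor"  (infixr \<open>\<otimes>\<close> 76)
  is "\<lambda>a b. Poly_Mapping.single (a, b) 1" .

lemma tensor_add_left: "(a + a') \<otimes> b = a \<otimes> b + a' \<otimes> b"
  and tensor_add_right: "a \<otimes> (b + b') = a \<otimes> b + a \<otimes> b'"
  and tensor_scale_left: "(c *\<^sub>C a) \<otimes> b = c *\<^sub>C (a \<otimes> b)"
  and tensor_scale_right: "a \<otimes> (c *\<^sub>C b) = c *\<^sub>C (a \<otimes> b)"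
  by (transfer, unfold tensor_rel_def, rule cvec.span_base,
      unfold tensor_relations_def diff_diff_eq[symmetric], blast)+

lemma cbilinear_tensor: "cbilinear (\<otimes>)"
  by (rule cbilinearI) (rule tensor_add_left tensor_add_right tensor_scale_left tensor_scale_right)+

lemma tensor_induct [case_names tensor add]:
  assumes "\<And>a b. P (a \<otimes> b)" "\<And>s t. P s \<Longrightarrow> P t \<Longrightarrow> P (s + t)"
  shows "P t"
proof -
  have 1: "P (c *\<^sub>C abs_tensor p)" for c p
  proof (induction p arbitrary: c rule: free_induct)
    case (1 k)
    have "abs_tensor (Poly_Mapping.single k 1) = fst k \<otimes> snd k"
      by (simp add: tensor.abs_eq)
    then show ?case using assms(1) by (simp flip: tensor_scale_left)
  next
    case (2 p q)
    have "c *\<^sub>C abs_tensor (p + q) = c *\<^sub>C abs_tensor p + c *\<^sub>C abs_tensor q"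
      by (simp flip: plus_tensor.abs_eq scaleC_add_right)
    then show ?case using assms(2) 2 by simp
  next
    case (3 d p)
    then show ?case by (simp add: scaleC_scaleC flip: scaleC_tensor.abs_eq)
  next
    case 4
    have "c *\<^sub>C abs_tensor 0 = (0 :: 'a) \<otimes> (0 :: 'b)"
      using tensor_scale_left[of 0 0 0]
      by (simp add: zero_tensor_def[symmetric] cvec.scale_zero_right)
    then show ?case using assms(1) by simp
  qed
  show ?thesis using 1[of 1 "rep_tensor t"]
    by (simp add: scaleC_one Quotient_abs_rep[OF Quotient_tensor])
qed

text \<open>The linear map on the tensor product induced by a bilinear map; meaningless for
  functions that are not bilinear, since a representative is chosen.\<close>

definition tensor_lift ::
  "('a::complex_vector \<Rightarrow> 'b::complex_vector \<Rightarrow> 'c::complex_vector) \<Rightarrow> ('a, 'b) tensor \<Rightarrow> 'c"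
  where "tensor_lift f t = free_lift (\<lambda>(a, b). f a b) (rep_tensor t)"

lemma tensor_lift_abs:
  assumes "cbilinear f"
  shows "tensor_lift f (abs_tensor p) = free_lift (\<lambda>(a, b). f a b) p"
proof -
  let ?L = "free_lift (\<lambda>(a, b). f a b)"
  have L: "clinear ?L" by (rule clinear_free_lift)
  have "tensor_rel (rep_tensor (abs_tensor p)) p"
    by (metis Quotient_rep_abs Quotient_tensor tensor.abs_eq_iff Quotient_abs_rep)
  then have "?L (rep_tensor (abs_tensor p) - p) = 0"
    unfolding tensor_rel_def
    by (rule clinear_span_zero[OF L, rotated])
      (auto simp: tensor_relations_def clinear_diff[OF L] clinear_scale[OF L] cbilinearD[OF assms]
        scaleC_one)
  then show ?thesis by (simp add: tensor_lift_def clinear_diff[OF L])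
qed

lemma tensor_lift_tensor:
  assumes "cbilinear f"
  shows "tensor_lift f (a \<otimes> b) = f a b"
  by (simp add: tensor.abs_eq tensor_lift_abs[OF assms] scaleC_one)

lemma clinear_tensor_lift:
  assumes "cbilinear f"
  shows "clinear (tensor_lift f)"
proof (rule clinearI)
  fix s t :: "('a, 'b) tensor" and c
  obtain p q where [simp]: "s = abs_tensor p" "t = abs_tensor q"
    by (metis Quotient_abs_rep Quotient_tensor)
  show "tensor_lift f (s + t) = tensor_lift f s + tensor_lift f t"
    by (simp add: plus_tensor.abs_eq tensor_lift_abs[OF assms] clinear_add[OF clinear_free_lift])
  show "tensor_lift f (c *\<^sub>C s) = c *\<^sub>C tensor_lift f s"
    by (simp add: scaleC_tensor.abs_eq tensor_lift_abs[OF assms] clinear_scale[OF clinear_free_lift])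
qed

lemma tensor_lift_add_fun:
  "tensor_lift (\<lambda>a b. f a b + g a b) t = tensor_lift f t + tensor_lift g t"
  by (simp add: tensor_lift_def free_lift_def case_prod_unfold scaleC_add_right sum.distrib)

lemma tensor_lift_scale_fun:
  "tensor_lift (\<lambda>a b. c *\<^sub>C f a b) t = c *\<^sub>C tensor_lift f t"
  by (simp add: tensor_lift_def free_lift_def case_prod_unfold scaleC_scaleC cvec.scale_sum_right
      mult.commute)


section \<open>Lie algebras\<close>

class lie_algebra = complex_vector +
  fixes bracket :: "'a \<Rightarrow> 'a \<Rightarrow> 'a"
  assumes bracket_add_left: "bracket (x + y) z = bracket x z + bracket y z"
    and bracket_add_right: "bracket x (y + z) = bracket x y + bracket x z"
    and bracket_scaleC_left: "bracket (c *\<^sub>C x) y = c *\<^sub>C bracket x y"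
    and bracket_scaleC_right: "bracket x (c *\<^sub>C y) = c *\<^sub>C bracket x y"
    and bracket_self: "bracket x x = 0"
    and jacobi: "bracket x (bracket y z) + bracket y (bracket z x) + bracket z (bracket x y) = 0"

lemma bracket_skew: "bracket x y = - bracket y (x :: 'a::lie_algebra)"
proof -
  have "0 = bracket (x + y) (x + y)" by (simp only: bracket_self)
  also have "\<dots> = bracket x y + bracket y x"
    unfolding bracket_add_left bracket_add_right by (simp add: bracket_self)
  finally have "bracket x y + bracket y x = 0" by (rule sym)
  then show ?thesis by (simp only: eq_neg_iff_add_eq_0)
qed

subsection \<open>The Lie algebra of a Lie algebra tensored with a commutative algebra\<close>

instantiation tensor :: (lie_algebra, complex_comm_algebra) lie_algebra
begin

definition bracket_tensor :: "('a, 'b) tensor \<Rightarrow> ('a, 'b) tensor \<Rightarrow> ('a, 'b) tensor"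
  where "bracket_tensor X Y =
    tensor_lift (\<lambda>x P. tensor_lift (\<lambda>y Q. bracket x y \<otimes> (P * Q)) Y) X"

lemma scaleC_mult_right': "x * (c *\<^sub>C y) = c *\<^sub>C (x * (y::'b))"
  by (metis scaleC_mult_left mult.commute)

lemma bracket_tensor_aux1: "cbilinear (\<lambda>y Q. bracket (x :: 'a) y \<otimes> (P * (Q :: 'b)))"
  by (rule cbilinearI)
    (simp_all add: bracket_add_right bracket_scaleC_right distrib_left scaleC_mult_right'
      tensor_add_left tensor_add_right tensor_scale_left tensor_scale_right)

lemma bracket_tensor_aux2:
  "cbilinear (\<lambda>x P. tensor_lift (\<lambda>y Q. bracket (x :: 'a) y \<otimes> (P * (Q :: 'b))) Y)"
  by (rule cbilinearI)
    (simp_all add: bracket_add_left bracket_scaleC_left distrib_right scaleC_mult_left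
      tensor_add_left tensor_add_right tensor_scale_left tensor_scale_right
      tensor_lift_add_fun tensor_lift_scale_fun)

lemma bracket_tensor_tensor:
  "bracket (x \<otimes> P) (y \<otimes> Q) = bracket (x :: 'a) y \<otimes> (P * (Q :: 'b))"
  unfolding bracket_tensor_def
  by (rule trans[OF tensor_lift_tensor[OF bracket_tensor_aux2] tensor_lift_tensor[OF bracket_tensor_aux1]])

instance
proof
  fix X Y Z :: "('a, 'b) tensor" and c :: complex
  have addl: "bracket (X + Y) Z = bracket X Z + bracket Y Z" for X Y Z :: "('a, 'b) tensor"
    unfolding bracket_tensor_def by (rule clinear_add[OF clinear_tensor_lift[OF bracket_tensor_aux2]])
  have addr: "bracket X (Y + Z) = bracket X Y + bracket X Z" for X Y Z :: "('a, 'b) tensor"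
    unfolding bracket_tensor_def
    by (simp add: clinear_add[OF clinear_tensor_lift[OF bracket_tensor_aux1]] tensor_lift_add_fun)
  have skew: "bracket X Y = - bracket Y X" for X Y :: "('a, 'b) tensor"
  proof (induction X rule: tensor_induct)
    case (tensor x P)
    show ?case
    proof (induction Y rule: tensor_induct)
      case (tensor y Q)
      have "bracket x y \<otimes> (P * Q) + bracket y x \<otimes> (Q * P) = 0"
        using cbilinearD(5)[OF cbilinear_tensor]
        by (simp add: bracket_skew[of x y] mult.commute flip: tensor_add_left)
      then show ?case by (simp add: bracket_tensor_tensor eq_neg_iff_add_eq_0)
    qed (simp add: addl addr)
  qed (simp add: addl addr)
  show "bracket (X + Y) Z = bracket X Z + bracket Y Z" by (rule addl)
  show "bracket X (Y + Z) = bracket X Y + bracket X Z" by (rule addr)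
  show "bracket (c *\<^sub>C X) Y = c *\<^sub>C bracket X Y"
    unfolding bracket_tensor_def by (rule clinear_scale[OF clinear_tensor_lift[OF bracket_tensor_aux2]])
  show "bracket X (c *\<^sub>C Y) = c *\<^sub>C bracket X Y"
    unfolding bracket_tensor_def
    by (simp add: clinear_scale[OF clinear_tensor_lift[OF bracket_tensor_aux1]] tensor_lift_scale_fun)
  have "2 *\<^sub>C bracket X X = bracket X X + bracket X X"
    using scaleC_add_left[of 1 1 "bracket X X"] by (simp add: scaleC_one)
  also have "\<dots> = 0" using skew[of X X] by (simp add: eq_neg_iff_add_eq_0)
  finally show "bracket X X = 0" using cvec.scale_eq_0_iff[of 2 "bracket X X"] by simp
  show "bracket X (bracket Y Z) + bracket Y (bracket Z X) + bracket Z (bracket X Y) = 0"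
  proof (induction X rule: tensor_induct)
    case (tensor x P)
    show ?case
    proof (induction Y rule: tensor_induct)
      case (tensor y Q)
      show ?case
      proof (induction Z rule: tensor_induct)
        case (tensor z R)
        have 1: "Q * (R * P) = P * (Q * R)" "R * (P * Q) = P * (Q * R)" by (simp_all add: ac_simps)
        show ?case
          unfolding bracket_tensor_tensor 1 tensor_add_left[symmetric] jacobi
          by (rule cbilinearD(5)[OF cbilinear_tensor])
      next
        case (add s t)
        have "bracket (x \<otimes> P) (bracket (y \<otimes> Q) (s + t)) + bracket (y \<otimes> Q) (bracket (s + t) (x \<otimes> P)) + bracket (s + t) (bracket (x \<otimes> P) (y \<otimes> Q)) =
          (bracket (x \<otimes> P) (bracket (y \<otimes> Q) s) + bracket (y \<otimes> Q) (bracket s (x \<otimes> P)) + bracket s (bracket (x \<otimes> P) (y \<otimes> Q))) +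
          (bracket (x \<otimes> P) (bracket (y \<otimes> Q) t) + bracket (y \<otimes> Q) (bracket t (x \<otimes> P)) + bracket t (bracket (x \<otimes> P) (y \<otimes> Q)))"
          by (simp only: addl addr ac_simps)
        then show ?case by (simp only: add add_0)
      qed
    next
      case (add s t)
      have "bracket (x \<otimes> P) (bracket (s + t) Z) + bracket (s + t) (bracket Z (x \<otimes> P)) + bracket Z (bracket (x \<otimes> P) (s + t)) =
        (bracket (x \<otimes> P) (bracket s Z) + bracket s (bracket Z (x \<otimes> P)) + bracket Z (bracket (x \<otimes> P) s)) +
        (bracket (x \<otimes> P) (bracket t Z) + bracket t (bracket Z (x \<otimes> P)) + bracket Z (bracket (x \<otimes> P) t))"
        by (simp only: addl addr ac_simps)
      then show ?case by (simp only: add add_0)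
    qed
  next
    case (add s t)
    have "bracket (s + t) (bracket Y Z) + bracket Y (bracket Z (s + t)) + bracket Z (bracket (s + t) Y) =
      (bracket s (bracket Y Z) + bracket Y (bracket Z s) + bracket Z (bracket s Y)) +
      (bracket t (bracket Y Z) + bracket Y (bracket Z t) + bracket Z (bracket t Y))"
      by (simp only: addl addr ac_simps)
    then show ?case by (simp only: add add_0)
  qed
qed

end

text \<open>\<open>'g current_algebra\<close> is \<open>\<gg>[t] = \<gg> \<otimes> \<complex>[t]\<close>; the element \<open>x(P)\<close> is \<open>x \<otimes> P\<close>.\<close>

type_synonym 'g current_algebra = "('g, complex poly) tensor"


subsection \<open>Representations\<close>

definition lie_rep :: "('l::lie_algebra \<Rightarrow> 'v::complex_vector \<Rightarrow> 'v) \<Rightarrow> bool"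
  where "lie_rep \<rho> \<longleftrightarrow> cbilinear \<rho> \<and>
    (\<forall>x y v. \<rho> (bracket x y) v = \<rho> x (\<rho> y v) - \<rho> y (\<rho> x v))"

definition submodule :: "('l::lie_algebra \<Rightarrow> 'v::complex_vector \<Rightarrow> 'v) \<Rightarrow> 'v set \<Rightarrow> bool"
  where "submodule \<rho> W \<longleftrightarrow> csubspace W \<and> (\<forall>x. \<forall>w\<in>W. \<rho> x w \<in> W)"

definition irreducible_rep :: "('l::lie_algebra \<Rightarrow> 'v::complex_vector \<Rightarrow> 'v) \<Rightarrow> bool"
  where "irreducible_rep \<rho> \<longleftrightarrow> lie_rep \<rho> \<and> (\<exists>v::'v. v \<noteq> 0) \<and>
    (\<forall>W. submodule \<rho> W \<longrightarrow> W = {0} \<or> W = UNIV)"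

definition tensor_rep ::
  "('l::lie_algebra \<Rightarrow> 'v::complex_vector \<Rightarrow> 'v) \<Rightarrow> ('l \<Rightarrow> 'w::complex_vector \<Rightarrow> 'w)
    \<Rightarrow> 'l \<Rightarrow> ('v, 'w) tensor \<Rightarrow> ('v, 'w) tensor"
  where "tensor_rep \<rho> \<sigma> x = tensor_lift (\<lambda>v w. \<rho> x v \<otimes> w + v \<otimes> \<sigma> x w)"

text \<open>The evaluation module at \<open>(p\<^sub>1, p\<^sub>2)\<close>: the action of \<open>x(P)\<close>, extended linearly to \<open>\<gg>[t]\<close>.\<close>

definition evaluation_rep ::
  "complex \<Rightarrow> complex \<Rightarrow> ('g::lie_algebra \<Rightarrow> 'v::complex_vector \<Rightarrow> 'v) \<Rightarrow>
    ('g \<Rightarrow> 'w::complex_vector \<Rightarrow> 'w) \<Rightarrow> 'g current_algebra \<Rightarrow> ('v, 'w) tensor \<Rightarrow> ('v, 'w) tensor"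
  where "evaluation_rep p1 p2 \<rho> \<sigma> X T =
    tensor_lift (\<lambda>x P.
      tensor_lift (\<lambda>v w. poly P p1 *\<^sub>C (\<rho> x v \<otimes> w) + poly P p2 *\<^sub>C (v \<otimes> \<sigma> x w)) T) X"

lemma lie_repD:
  assumes "lie_rep \<rho>"
  shows "cbilinear \<rho>" "\<rho> (bracket x y) v = \<rho> x (\<rho> y v) - \<rho> y (\<rho> x v)"
  using assms by (auto simp: lie_rep_def)

lemma poly_scaleC: "poly (c *\<^sub>C P) a = c * poly P (a :: complex)"
proof -
  have "c *\<^sub>C P = smult c P"
    by (simp add: poly_eq_iff scaleC_poly_def coeff_map_poly scaleC_complex_def)
  then show ?thesis by simp
qed

lemma cbilinear_evaluation_inner:
  assumes "lie_rep \<rho>" "lie_rep \<sigma>"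
  shows "cbilinear (\<lambda>v w. a *\<^sub>C (\<rho> x v \<otimes> w) + b *\<^sub>C (v \<otimes> \<sigma> x w))"
  by (rule cbilinearI)
    (simp_all add: cbilinearD[OF lie_repD(1)[OF assms(1)]] cbilinearD[OF lie_repD(1)[OF assms(2)]]
      tensor_add_left tensor_add_right tensor_scale_left tensor_scale_right
      scaleC_add_right scaleC_scaleC mult.commute add_ac)

lemma cbilinear_evaluation_outer:
  assumes "lie_rep \<rho>" "lie_rep \<sigma>"
  shows "cbilinear (\<lambda>x P. tensor_lift
    (\<lambda>v w. poly P p1 *\<^sub>C (\<rho> x v \<otimes> w) + poly P p2 *\<^sub>C (v \<otimes> \<sigma> x w)) T)"
  by (rule cbilinearI; unfold tensor_lift_add_fun[symmetric] tensor_lift_scale_fun[symmetric];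
      rule arg_cong2[OF _ refl, of _ _ tensor_lift]; intro ext)
    (simp_all add: cbilinearD[OF lie_repD(1)[OF assms(1)]] cbilinearD[OF lie_repD(1)[OF assms(2)]]
      tensor_add_left tensor_add_right tensor_scale_left tensor_scale_right poly_scaleC
      scaleC_add_right scaleC_add_left scaleC_scaleC mult.commute add_ac)

lemma evaluation_rep_pure:
  assumes "lie_rep \<rho>" "lie_rep \<sigma>"
  shows "evaluation_rep p1 p2 \<rho> \<sigma> (x \<otimes> P) T =
    tensor_lift (\<lambda>v w. poly P p1 *\<^sub>C (\<rho> x v \<otimes> w) + poly P p2 *\<^sub>C (v \<otimes> \<sigma> x w)) T"
  unfolding evaluation_rep_def by (rule tensor_lift_tensor[OF cbilinear_evaluation_outer[OF assms]])

lemma evaluation_rep_tensor: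
  assumes "lie_rep \<rho>" "lie_rep \<sigma>"
  shows "evaluation_rep p1 p2 \<rho> \<sigma> (x \<otimes> P) (v \<otimes> w) =
    poly P p1 *\<^sub>C (\<rho> x v \<otimes> w) + poly P p2 *\<^sub>C (v \<otimes> \<sigma> x w)"
  unfolding evaluation_rep_pure[OF assms]
  by (rule tensor_lift_tensor[OF cbilinear_evaluation_inner[OF assms]])

lemma evaluation_rep_one:
  assumes "lie_rep \<rho>" "lie_rep \<sigma>"
  shows "evaluation_rep p1 p2 \<rho> \<sigma> (x \<otimes> 1) = tensor_rep \<rho> \<sigma> x"
  by (rule ext) (simp add: evaluation_rep_pure[OF assms] tensor_rep_def scaleC_one)

lemma lie_rep_evaluation_rep:
  assumes "lie_rep \<rho>" "lie_rep \<sigma>"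
  shows "lie_rep (evaluation_rep p1 p2 \<rho> \<sigma>)"
proof -
  let ?E = "evaluation_rep p1 p2 \<rho> \<sigma>"
  have X: "clinear (\<lambda>X. ?E X T)" for T
    unfolding evaluation_rep_def
    by (rule clinear_tensor_lift[OF cbilinear_evaluation_outer[OF assms]])
  have pure: "clinear (?E (x \<otimes> P))" for x P
    unfolding evaluation_rep_pure[OF assms, abs_def]
    by (rule clinear_tensor_lift[OF cbilinear_evaluation_inner[OF assms]])
  have T: "clinear (?E Y)" for Y
  proof (induction Y rule: tensor_induct)
    case (add s t)
    show ?case
      by (rule clinearI) (simp_all add: clinear_add[OF X] clinear_add[OF add(1)] clinear_add[OF add(2)]
          clinear_scale[OF add(1)] clinear_scale[OF add(2)] scaleC_add_right add_ac)
  qed (rule pure)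
  have "?E (bracket Y Z) t = ?E Y (?E Z t) - ?E Z (?E Y t)" for Y Z t
  proof (induction Y rule: tensor_induct)
    case (tensor x P)
    show ?case
    proof (induction Z rule: tensor_induct)
      case (tensor y Q)
      show ?case
      proof (induction t rule: tensor_induct)
        case (tensor v w)
        have diff_left: "(a - b) \<otimes> c = a \<otimes> c - b \<otimes> c" for a b :: 'b and c :: 'c
          using tensor_add_left[of "a - b" b c] by (simp add: eq_diff_eq)
        have diff_right: "c \<otimes> (a - b) = c \<otimes> a - c \<otimes> b" for a b :: 'c and c :: 'b
          using tensor_add_right[of c "a - b" b] by (simp add: eq_diff_eq)
        show ?case
          by (simp add: bracket_tensor_tensor evaluation_rep_tensor[OF assms]
              lie_repD(2)[OF assms(1)] lie_repD(2)[OF assms(2)] diff_left diff_right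
              clinear_add[OF pure] clinear_scale[OF pure] scaleC_add_right scaleC_scaleC
              cvec.scale_right_diff_distrib mult.commute)
      qed (simp_all add: clinear_add[OF pure] clinear_add[OF T])
    qed (simp_all add: bracket_add_right clinear_add[OF X] clinear_add[OF T])
  qed (simp_all add: bracket_add_left clinear_add[OF X] clinear_add[OF T])
  then show ?thesis using X T by (simp add: lie_rep_def cbilinear_def)
qed

text \<open>The sum of all submodules of \<open>\<sigma>\<close> that are isomorphic to the module \<open>\<rho>\<close>.\<close>

definition isotypic_component ::
  "('l::lie_algebra \<Rightarrow> 'v::complex_vector \<Rightarrow> 'v) \<Rightarrow> ('l \<Rightarrow> 'w::complex_vector \<Rightarrow> 'w) \<Rightarrow> 'w set"
  where "isotypic_component \<rho> \<sigma> =
    cspan (\<Union>{W. submodule \<sigma> W \<and>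
      (\<exists>f. clinear f \<and> bij_betw f UNIV W \<and> (\<forall>x v. f (\<rho> x v) = \<sigma> x (f v)))})"


subsection \<open>The universal enveloping algebra\<close>

text \<open>The free associative algebra on \<open>'l\<close> is the monoid algebra \<open>'l monomial \<Rightarrow>\<^sub>0 complex\<close>
  of the free monoid.\<close>

datatype 'l monomial = Monomial (letters: "'l list")

instantiation monomial :: (type) monoid_add
begin
definition zero_monomial :: "'a monomial" where "zero_monomial = Monomial []"
definition plus_monomial :: "'a monomial \<Rightarrow> 'a monomial \<Rightarrow> 'a monomial"
  where "plus_monomial m n = Monomial (letters m @ letters n)"
instance by standard (simp_all add: zero_monomial_def plus_monomial_def)
end

definition generator :: "'l \<Rightarrow> ('l monomial \<Rightarrow>\<^sub>0 complex)"
  where "generator x = Poly_Mapping.single (Monomial [x]) 1"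

definition uea_relations :: "('l::lie_algebra monomial \<Rightarrow>\<^sub>0 complex) set"
  where "uea_relations =
      {generator (x + y) - generator x - generator y |x y. True}
    \<union> {generator (c *\<^sub>C x) - c *\<^sub>C generator x |c x. True}
    \<union> {generator x * generator y - generator y * generator x - generator (bracket x y) |x y. True}"

definition uea_ideal_generators :: "('l::lie_algebra monomial \<Rightarrow>\<^sub>0 complex) set"
  where "uea_ideal_generators = {a * r * b |a r b. r \<in> uea_relations}"

definition uea_rel ::
  "('l::lie_algebra monomial \<Rightarrow>\<^sub>0 complex) \<Rightarrow> ('l monomial \<Rightarrow>\<^sub>0 complex) \<Rightarrow> bool"
  where "uea_rel p q \<longleftrightarrow> p - q \<in> cspan uea_ideal_generators"

lemma scaleC_conv_mult: "c *\<^sub>C p = Poly_Mapping.single 0 c * (p :: 'k::monoid_add \<Rightarrow>\<^sub>0 complex)"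
proof -
  have "scaleC c = (\<lambda>d :: complex. c * d)" by (rule ext) (simp add: scaleC_complex_def)
  then show ?thesis by (simp add: scaleC_poly_mapping_def mult_map_scale_conv_mult)
qed

lemma single_0_commute:
  "p * Poly_Mapping.single 0 c = Poly_Mapping.single 0 c * (p :: 'k::monoid_add \<Rightarrow>\<^sub>0 complex)"
proof (induction p rule: free_induct)
  case (1 k)
  show ?case by (simp add: mult_single)
next
  case (2 p q)
  then show ?case by (simp add: distrib_left distrib_right)
next
  case (3 d p)
  have "(d *\<^sub>C p) * Poly_Mapping.single 0 c
      = Poly_Mapping.single 0 d * Poly_Mapping.single 0 c * p"
    by (simp add: scaleC_conv_mult mult.assoc 3)
  also have "\<dots> = Poly_Mapping.single 0 c * Poly_Mapping.single 0 d * p"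
    by (simp add: mult_single mult.commute)
  finally show ?case by (simp add: scaleC_conv_mult mult.assoc)
qed simp

lemma free_scaleC_mult_left: "(c *\<^sub>C p) * q = c *\<^sub>C (p * (q :: 'k::monoid_add \<Rightarrow>\<^sub>0 complex))"
  by (simp add: scaleC_conv_mult mult.assoc)

lemma free_scaleC_mult_right: "p * (c *\<^sub>C q) = c *\<^sub>C (p * (q :: 'k::monoid_add \<Rightarrow>\<^sub>0 complex))"
  by (simp add: scaleC_conv_mult single_0_commute flip: mult.assoc)

lemma uea_ideal_mult_left: "p \<in> cspan uea_ideal_generators \<Longrightarrow> a * p \<in> cspan uea_ideal_generators"
proof (induction rule: cvec.span_induct_alt)
  case base
  show ?case by (simp add: cvec.span_zero)
next
  case (step c x y)
  have "a * x \<in> uea_ideal_generators"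
  proof -
    obtain a' r b where "x = a' * r * b" "r \<in> uea_relations"
      using step(1) unfolding uea_ideal_generators_def by auto
    then have "a * x = (a * a') * r * b" by (simp add: mult.assoc)
    with \<open>r \<in> uea_relations\<close> show ?thesis unfolding uea_ideal_generators_def by blast
  qed
  then show ?case
    using step by (simp add: distrib_left free_scaleC_mult_right cvec.span_add cvec.span_scale cvec.span_base)
qed

lemma uea_ideal_mult_right: "p \<in> cspan uea_ideal_generators \<Longrightarrow> p * b \<in> cspan uea_ideal_generators"
proof (induction rule: cvec.span_induct_alt)
  case base
  show ?case by (simp add: cvec.span_zero)
next
  case (step c x y)
  have "x * b \<in> uea_ideal_generators"
  proof -
    obtain a r b' where "x = a * r * b'" "r \<in> uea_relations"
      using step(1) unfolding uea_ideal_generators_def by auto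
    then have "x * b = a * r * (b' * b)" by (simp add: mult.assoc)
    with \<open>r \<in> uea_relations\<close> show ?thesis unfolding uea_ideal_generators_def by blast
  qed
  then show ?case
    using step by (simp add: distrib_right free_scaleC_mult_left cvec.span_add cvec.span_scale cvec.span_base)
qed

quotient_type (overloaded) 'l uea = "'l::lie_algebra monomial \<Rightarrow>\<^sub>0 complex" / uea_rel
  morphisms rep_uea abs_uea
  unfolding uea_rel_def[abs_def] by (rule equivp_span_diff)

instantiation uea :: (lie_algebra) "{ring, monoid_mult, complex_vector}"
begin

lift_definition zero_uea :: "'a uea" is 0 .
lift_definition one_uea :: "'a uea" is 1 .
lift_definition plus_uea :: "'a uea \<Rightarrow> 'a uea \<Rightarrow> 'a uea" is "(+)"
  unfolding uea_rel_def by (rule span_diff_add)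
lift_definition minus_uea :: "'a uea \<Rightarrow> 'a uea \<Rightarrow> 'a uea" is "(-)"
  unfolding uea_rel_def by (rule span_diff_diff)
lift_definition uminus_uea :: "'a uea \<Rightarrow> 'a uea" is uminus
  unfolding uea_rel_def by (rule span_diff_minus)
lift_definition scaleC_uea :: "complex \<Rightarrow> 'a uea \<Rightarrow> 'a uea" is scaleC
  unfolding uea_rel_def by (rule span_diff_scale)
lift_definition times_uea :: "'a uea \<Rightarrow> 'a uea \<Rightarrow> 'a uea" is "(*)"
proof -
  fix p p' q q' :: "'a monomial \<Rightarrow>\<^sub>0 complex"
  assume "uea_rel p p'" "uea_rel q q'"
  then have "p * (q - q') + (p - p') * q' \<in> cspan uea_ideal_generators"
    unfolding uea_rel_def by (intro cvec.span_add uea_ideal_mult_left uea_ideal_mult_right)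
  then show "uea_rel (p * q) (p' * q')"
    by (simp add: uea_rel_def algebra_simps)
qed

instance
  by standard
    (transfer, simp add: uea_rel_def cvec.span_zero algebra_simps
      scaleC_add_right scaleC_add_left scaleC_scaleC scaleC_one)+

end

lift_definition uea_of :: "'l::lie_algebra \<Rightarrow> 'l uea" is generator .

definition monomial_act ::
  "('l::lie_algebra \<Rightarrow> 'v::complex_vector \<Rightarrow> 'v) \<Rightarrow> ('l monomial \<Rightarrow>\<^sub>0 complex) \<Rightarrow> 'v \<Rightarrow> 'v"
  where "monomial_act \<rho> p v = free_lift (\<lambda>m. foldr \<rho> (letters m) v) p"

text \<open>The action of \<open>U(\<ll>)\<close> on an \<open>\<ll>\<close>-module \<open>\<rho>\<close>. The lemmas below show that it does not depend on
  representatives and is the algebra action extending \<open>\<rho>\<close> if \<open>\<rho>\<close> is a representation.\<close>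

definition uea_act :: "('l::lie_algebra \<Rightarrow> 'v::complex_vector \<Rightarrow> 'v) \<Rightarrow> 'l uea \<Rightarrow> 'v \<Rightarrow> 'v"
  where "uea_act \<rho> u v = monomial_act \<rho> (rep_uea u) v"

lemma clinear_monomial_act: "clinear (\<lambda>p. monomial_act \<rho> p v)"
  unfolding monomial_act_def by (rule clinear_free_lift)

lemma clinear_foldr:
  assumes "lie_rep \<rho>"
  shows "clinear (foldr \<rho> xs)"
proof (induction xs)
  case Nil
  show ?case by (rule clinearI) simp_all
next
  case (Cons x xs)
  then show ?case
    using assms by (intro clinearI) (simp_all add: lie_rep_def cbilinearD clinear_add[OF Cons] clinear_scale[OF Cons])
qed

lemma monomial_act_single: "monomial_act \<rho> (Poly_Mapping.single m c) v = c *\<^sub>C foldr \<rho> (letters m) v"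
  by (simp add: monomial_act_def)

lemma clinear_monomial_act_vector:
  assumes "lie_rep \<rho>"
  shows "clinear (monomial_act \<rho> p)"
proof (induction p rule: free_induct)
  case (1 m)
  then show ?case
    by (intro clinearI) (simp_all add: monomial_act_single scaleC_one clinear_add[OF clinear_foldr[OF assms]]
        clinear_scale[OF clinear_foldr[OF assms]])
next
  case (2 p q)
  then show ?case
    by (intro clinearI) (simp_all add: clinear_add[OF clinear_monomial_act]
        clinear_add[OF 2(1)] clinear_scale[OF 2(1)] clinear_add[OF 2(2)] clinear_scale[OF 2(2)]
        scaleC_add_right algebra_simps)
next
  case (3 c p)
  then show ?case
    by (intro clinearI) (simp_all add: clinear_scale[OF clinear_monomial_act]
        clinear_add[OF 3] clinear_scale[OF 3]
        scaleC_add_right scaleC_scaleC mult.commute)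
next
  case 4
  then show ?case
    by (intro clinearI) (simp_all add: clinear_0[OF clinear_monomial_act] scaleC_0_right)
qed

lemma monomial_act_mult:
  assumes "lie_rep \<rho>"
  shows "monomial_act \<rho> (p * q) v = monomial_act \<rho> p (monomial_act \<rho> q v)"
proof (induction p rule: free_induct)
  case (1 m)
  show ?case
  proof (induction q rule: free_induct)
    case (1 n)
    show ?case by (simp add: mult_single monomial_act_single scaleC_one plus_monomial_def)
  qed (simp_all add: distrib_left free_scaleC_mult_right clinear_add[OF clinear_monomial_act]
      clinear_scale[OF clinear_monomial_act] clinear_0[OF clinear_monomial_act]
      clinear_add[OF clinear_monomial_act_vector[OF assms]]
      clinear_scale[OF clinear_monomial_act_vector[OF assms]]
      clinear_0[OF clinear_monomial_act_vector[OF assms]])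
qed (simp_all add: distrib_right free_scaleC_mult_left clinear_add[OF clinear_monomial_act]
    clinear_scale[OF clinear_monomial_act] clinear_0[OF clinear_monomial_act])

lemma monomial_act_generator: "monomial_act \<rho> (generator x) v = \<rho> x v"
  by (simp add: generator_def monomial_act_single scaleC_one)

lemma monomial_act_relation:
  assumes "lie_rep \<rho>" "r \<in> uea_relations"
  shows "monomial_act \<rho> r v = 0"
proof -
  have "cbilinear \<rho>" "\<And>x y v. \<rho> (bracket x y) v = \<rho> x (\<rho> y v) - \<rho> y (\<rho> x v)"
    using assms(1) by (auto simp: lie_rep_def)
  then show ?thesis
    using assms(2)
    by (auto simp: uea_relations_def clinear_diff[OF clinear_monomial_act]
        clinear_scale[OF clinear_monomial_act] monomial_act_generator monomial_act_mult[OF assms(1)]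
        cbilinearD)
qed

lemma uea_act_abs:
  assumes "lie_rep \<rho>"
  shows "uea_act \<rho> (abs_uea p) v = monomial_act \<rho> p v"
proof -
  have "uea_rel (rep_uea (abs_uea p)) p"
    by (metis Quotient_uea uea.abs_eq_iff Quotient_abs_rep)
  then have "monomial_act \<rho> (rep_uea (abs_uea p) - p) v = 0"
    unfolding uea_rel_def
    by (rule clinear_span_zero[OF clinear_monomial_act, rotated])
      (auto simp: uea_ideal_generators_def monomial_act_mult[OF assms]
        monomial_act_relation[OF assms] clinear_0[OF clinear_monomial_act_vector[OF assms]])
  then show ?thesis by (simp add: uea_act_def clinear_diff[OF clinear_monomial_act])
qed

lemma uea_act_uea_of: "lie_rep \<rho> \<Longrightarrow> uea_act \<rho> (uea_of x) v = \<rho> x v"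
  by (simp add: uea_of.abs_eq uea_act_abs monomial_act_generator)

lemma uea_act_mult:
  assumes "lie_rep \<rho>"
  shows "uea_act \<rho> (a * b) v = uea_act \<rho> a (uea_act \<rho> b v)"
proof -
  obtain p q where [simp]: "a = abs_uea p" "b = abs_uea q"
    by (metis Quotient_abs_rep Quotient_uea)
  show ?thesis by (simp add: times_uea.abs_eq uea_act_abs[OF assms] monomial_act_mult[OF assms])
qed

lemma clinear_uea_act:
  fixes \<rho> :: "'l::lie_algebra \<Rightarrow> 'v::complex_vector \<Rightarrow> 'v"
  assumes "lie_rep \<rho>"
  shows "clinear (\<lambda>a. uea_act \<rho> a v)"
proof (rule clinearI)
  fix a b :: "'l uea" and c
  obtain p q where [simp]: "a = abs_uea p" "b = abs_uea q"
    by (metis Quotient_abs_rep Quotient_uea)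
  show "uea_act \<rho> (a + b) v = uea_act \<rho> a v + uea_act \<rho> b v"
    by (simp add: plus_uea.abs_eq uea_act_abs[OF assms] clinear_add[OF clinear_monomial_act])
  show "uea_act \<rho> (c *\<^sub>C a) v = c *\<^sub>C uea_act \<rho> a v"
    by (simp add: scaleC_uea.abs_eq uea_act_abs[OF assms] clinear_scale[OF clinear_monomial_act])
qed


subsection \<open>Reductive Lie algebras\<close>

definition lie_subalgebra :: "'g::lie_algebra set \<Rightarrow> bool"
  where "lie_subalgebra S \<longleftrightarrow> csubspace S \<and> (\<forall>x\<in>S. \<forall>y\<in>S. bracket x y \<in> S)"

definition lie_ideal :: "'g::lie_algebra set \<Rightarrow> bool"
  where "lie_ideal I \<longleftrightarrow> csubspace I \<and> (\<forall>x. \<forall>y\<in>I. bracket x y \<in> I)"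

definition bracket_span :: "'g::lie_algebra set \<Rightarrow> 'g set \<Rightarrow> 'g set"
  where "bracket_span S T = cspan {bracket x y |x y. x \<in> S \<and> y \<in> T}"

definition solvable :: "'g::lie_algebra set \<Rightarrow> bool"
  where "solvable S \<longleftrightarrow> (\<exists>n. ((\<lambda>T. bracket_span T T) ^^ n) S = {0})"

definition nilpotent :: "'g::lie_algebra set \<Rightarrow> bool"
  where "nilpotent S \<longleftrightarrow> (\<exists>n. (bracket_span S ^^ n) S = {0})"

definition radical :: "'g::lie_algebra set"
  where "radical = cspan (\<Union>{I. lie_ideal I \<and> solvable I})"

definition center :: "'g::lie_algebra set"
  where "center = {z. \<forall>x. bracket x z = 0}"

definition reductive :: "'g::lie_algebra itself \<Rightarrow> bool"
  where "reductive _ \<longleftrightarrow> (radical :: 'g set) = center"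


subsection \<open>Weights\<close>

definition cartan_subalgebra :: "'g::lie_algebra set \<Rightarrow> bool"
  where "cartan_subalgebra H \<longleftrightarrow> lie_subalgebra H \<and> nilpotent H \<and>
    (\<forall>x. (\<forall>h\<in>H. bracket x h \<in> H) \<longrightarrow> x \<in> H)"

text \<open>A linear functional on \<open>H\<close> is represented by its extension by zero to a function on all of
  \<open>'g\<close>; this extension is not linear on \<open>'g\<close>.\<close>

definition dual_space :: "'g::complex_vector set \<Rightarrow> ('g \<Rightarrow> complex) set"
  where "dual_space H = {\<nu>. (\<forall>x\<in>H. \<forall>y\<in>H. \<nu> (x + y) = \<nu> x + \<nu> y) \<and>
    (\<forall>c. \<forall>x\<in>H. \<nu> (c *\<^sub>C x) = c * \<nu> x) \<and> (\<forall>x. x \<notin> H \<longrightarrow> \<nu> x = 0)}"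

definition root_space :: "'g::lie_algebra set \<Rightarrow> ('g \<Rightarrow> complex) \<Rightarrow> 'g set"
  where "root_space H \<alpha> = {x. \<forall>h\<in>H. bracket h x = \<alpha> h *\<^sub>C x}"

definition roots :: "'g::lie_algebra set \<Rightarrow> ('g \<Rightarrow> complex) set"
  where "roots H = {\<alpha> \<in> dual_space H. \<alpha> \<noteq> (\<lambda>_. 0) \<and> root_space H \<alpha> \<noteq> {0}}"

definition positive_system :: "'g::lie_algebra set \<Rightarrow> ('g \<Rightarrow> complex) set \<Rightarrow> bool"
  where "positive_system H Pos \<longleftrightarrow> Pos \<subseteq> roots H \<and>
    (\<forall>\<alpha>\<in>roots H. (\<alpha> \<in> Pos) \<noteq> ((\<lambda>h. - \<alpha> h) \<in> Pos)) \<and>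
    (\<forall>\<alpha>\<in>Pos. \<forall>\<beta>\<in>Pos. (\<lambda>h. \<alpha> h + \<beta> h) \<in> roots H \<longrightarrow> (\<lambda>h. \<alpha> h + \<beta> h) \<in> Pos)"

definition coroot :: "'g::lie_algebra set \<Rightarrow> ('g \<Rightarrow> complex) \<Rightarrow> 'g"
  where "coroot H \<alpha> =
    (THE h. h \<in> bracket_span (root_space H \<alpha>) (root_space H (\<lambda>h. - \<alpha> h)) \<and> \<alpha> h = 2)"

definition dominant_integral ::
  "'g::lie_algebra set \<Rightarrow> ('g \<Rightarrow> complex) set \<Rightarrow> ('g \<Rightarrow> complex) \<Rightarrow> bool"
  where "dominant_integral H Pos \<nu> \<longleftrightarrow> \<nu> \<in> dual_space H \<and> (\<forall>\<alpha>\<in>Pos. \<nu> (coroot H \<alpha>) \<in> \<nat>)"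

text \<open>\<open>\<rho>\<close> is a model of \<open>V(\<nu>)\<close>, the finite dimensional irreducible module of highest weight \<open>\<nu>\<close>.\<close>

definition irreducible_highest_weight_rep ::
  "'g::lie_algebra set \<Rightarrow> ('g \<Rightarrow> complex) set \<Rightarrow> ('g \<Rightarrow> complex) \<Rightarrow>
    ('g \<Rightarrow> 'v::complex_vector \<Rightarrow> 'v) \<Rightarrow> bool"
  where "irreducible_highest_weight_rep H Pos \<nu> \<rho> \<longleftrightarrow>
    finite_dimensional TYPE('v) \<and> irreducible_rep \<rho> \<and> \<nu> \<in> dual_space H \<and>
    (\<exists>v. v \<noteq> 0 \<and> (\<forall>h\<in>H. \<rho> h v = \<nu> h *\<^sub>C v) \<and>
      (\<forall>\<alpha>\<in>Pos. \<forall>x\<in>root_space H \<alpha>. \<rho> x v = 0))"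


subsection \<open>The Casimir element\<close>

definition invariant_form :: "('g::lie_algebra \<Rightarrow> 'g \<Rightarrow> complex) \<Rightarrow> bool"
  where "invariant_form B \<longleftrightarrow> (\<forall>x y z. B (bracket x y) z = B x (bracket y z))"

definition symmetric_form :: "('g \<Rightarrow> 'g \<Rightarrow> complex) \<Rightarrow> bool"
  where "symmetric_form B \<longleftrightarrow> (\<forall>x y. B x y = B y x)"

definition nondegenerate_form :: "('g::zero \<Rightarrow> 'g \<Rightarrow> complex) \<Rightarrow> bool"
  where "nondegenerate_form B \<longleftrightarrow> (\<forall>x. (\<forall>y. B x y = 0) \<longrightarrow> x = 0)"

definition dual_vector :: "('g::complex_vector \<Rightarrow> 'g \<Rightarrow> complex) \<Rightarrow> 'g set \<Rightarrow> 'g \<Rightarrow> 'g"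
  where "dual_vector B E e = (THE f. \<forall>e'\<in>E. B e' f = (if e' = e then 1 else 0))"

definition casimir :: "('g::lie_algebra \<Rightarrow> 'g \<Rightarrow> complex) \<Rightarrow> 'g set \<Rightarrow> ('g, 'g) tensor"
  where "casimir B E = (\<Sum>e\<in>E. e \<otimes> dual_vector B E e)"

text \<open>Elements of \<open>\<gg> \<otimes> \<gg>\<close> act on a module through \<open>x \<otimes> y \<mapsto> x y\<close>.\<close>

definition tensor_square_act ::
  "('g::lie_algebra \<Rightarrow> 'v::complex_vector \<Rightarrow> 'v) \<Rightarrow> ('g, 'g) tensor \<Rightarrow> 'v \<Rightarrow> 'v"
  where "tensor_square_act \<rho> r v = tensor_lift (\<lambda>x y. \<rho> x (\<rho> y v)) r"

lemma tensor_square_act_casimir: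
  assumes "lie_rep \<rho>"
  shows "tensor_square_act \<rho> (casimir B E) v = (\<Sum>e\<in>E. \<rho> e (\<rho> (dual_vector B E e) v))"
proof -
  have b: "cbilinear (\<lambda>x y. \<rho> x (\<rho> y v))"
    by (rule cbilinearI) (simp_all add: cbilinearD[OF lie_repD(1)[OF assms]])
  show ?thesis
    unfolding tensor_square_act_def casimir_def clinear_sum[OF clinear_tensor_lift[OF b]]
    by (simp add: tensor_lift_tensor[OF b])
qed

text \<open>\<open>C\<^sub>\<nu>\<close>, if \<open>\<rho>\<close> is \<open>V(\<nu>)\<close>.\<close>

definition casimir_scalar ::
  "('g::lie_algebra \<Rightarrow> 'g \<Rightarrow> complex) \<Rightarrow> 'g set \<Rightarrow> ('g \<Rightarrow> 'v::complex_vector \<Rightarrow> 'v) \<Rightarrow> complex"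
  where "casimir_scalar B E \<rho> = (THE c. \<forall>v. tensor_square_act \<rho> (casimir B E) v = c *\<^sub>C v)"

definition casimir_poly ::
  "('g::lie_algebra \<Rightarrow> 'g \<Rightarrow> complex) \<Rightarrow> 'g set \<Rightarrow> complex poly \<Rightarrow> complex poly \<Rightarrow> 'g current_algebra uea"
  where "casimir_poly B E P Q = (\<Sum>e\<in>E. uea_of (e \<otimes> P) * uea_of (dual_vector B E e \<otimes> Q))"

end

theory Submission
  imports Defs "HOL-Computational_Algebra.Fundamental_Theorem_Algebra"
begin

text \<open>Invariance of the form makes the Casimir element act on every representation by an
  intertwiner, hence by a scalar on irreducible ones (Schur's lemma). On pure tensors,
  \<open>\<Omega>(P, Q)\<close> acts as \<open>w\<^sub>1 z\<^sub>1 \<Omega> \<otimes> 1 + w\<^sub>2 z\<^sub>2 1 \<otimes> \<Omega> + (w\<^sub>1 z\<^sub>2 + w\<^sub>2 z\<^sub>1) X\<close> with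
  \<open>X = \<Sum> e\<^sub>i \<otimes> e\<^sup>i\<close>, where the two mixed terms agree because the Casimir element is symmetric.
  The case \<open>P = Q = 1\<close> expresses \<open>X\<close> through the Casimir action on the tensor product, which is
  the scalar \<open>C\<^sub>\<mu>\<close> on the isotypic component.\<close>

subsection \<open>Eigenvectors and Schur's lemma\<close>

text \<open>This is \<open>p(T) v\<close>, evaluated by Horner's scheme so that induction over
  \<open>pCons\<close> applies.\<close>

definition poly_act ::
  "('v::complex_vector \<Rightarrow> 'v) \<Rightarrow> 'v \<Rightarrow> complex poly \<Rightarrow> 'v"
  where "poly_act T v p = fold_coeffs (\<lambda>a u. a *\<^sub>C v + T u) p 0"

lemma poly_act_0 [simp]: "poly_act T v 0 = 0"
  by (simp add: poly_act_def)

lemma poly_act_pCons: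
  assumes "clinear T"
  shows "poly_act T v (pCons a p) = a *\<^sub>C v + T (poly_act T v p)"
  by (cases "p = 0"; cases "a = 0") (simp_all add: poly_act_def clinear_0[OF assms])

lemma poly_act_add:
  assumes "clinear T"
  shows "poly_act T v (p + q) = poly_act T v p + poly_act T v q"
proof (induction p arbitrary: q)
  case 0
  show ?case by simp
next
  case (pCons a p)
  show ?case
    by (cases q) (simp add: poly_act_pCons[OF assms] pCons.IH clinear_add[OF assms] scaleC_add_left)
qed

lemma poly_act_smult:
  assumes "clinear T"
  shows "poly_act T v (smult c p) = c *\<^sub>C poly_act T v p"
  by (induction p) (simp_all add: poly_act_pCons[OF assms] clinear_scale[OF assms] scaleC_add_right
      scaleC_scaleC scaleC_0_right)

lemma poly_act_sum:
  assumes "clinear T"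
  shows "poly_act T v (\<Sum>i\<in>A. p i) = (\<Sum>i\<in>A. poly_act T v (p i))"
  by (induction A rule: infinite_finite_induct) (simp_all add: poly_act_add[OF assms])

lemma poly_act_monom:
  assumes "clinear T"
  shows "poly_act T v (monom c n) = c *\<^sub>C (T ^^ n) v"
  by (induction n) (simp_all add: monom_0 monom_Suc poly_act_pCons[OF assms] clinear_0[OF assms]
      clinear_scale[OF assms])

text \<open>The iterates \<open>(T ^^ n) v\<close> cannot all be independent in finite dimension,
  and a linear relation among them is a polynomial in \<open>T\<close> killing
  \<open>v\<close>.\<close>

lemma ex_annihilating_poly:
  fixes T :: "'v::complex_vector \<Rightarrow> 'v"
  assumes "finite_dimensional TYPE('v)" "clinear T"
  obtains p where "p \<noteq> 0" "poly_act T v p = 0"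
\<comment> \<open>Dependence is a property of sets of vectors, so a repeated iterate is invisible in
  the range and needs its own polynomial, \<open>t^i - t^j\<close>.\<close>
proof (cases "inj (\<lambda>n. (T ^^ n) v)")
  case False
  then obtain i j where ij: "i \<noteq> j" "(T ^^ i) v = (T ^^ j) v"
    by (auto simp: inj_def)
  define p :: "complex poly" where "p = monom 1 i + monom (-1) j"
  have "coeff p i = 1" using ij(1) by (simp add: p_def)
  then have "p \<noteq> 0" by auto
  moreover have "poly_act T v p = 0"
    using ij(2) by (simp add: p_def poly_act_add[OF assms(2)] poly_act_monom[OF assms(2)] flip: scaleC_add_left)
  ultimately show ?thesis by (rule that)
next
  case True
  let ?g = "\<lambda>n. (T ^^ n) v"
  obtain S :: "'v set" where "finite S" "cspan S = UNIV"
    using assms(1) by (auto simp: finite_dimensional_def)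
  then have "finite D" if "\<not> cdependent D" for D :: "'v set"
    using cvec.independent_span_bound[of S D] that by auto
  moreover have "infinite (range ?g)"
    using True finite_imageD by blast
  ultimately have "cdependent (range ?g)" by blast
  then obtain U u y where U: "finite U" "U \<subseteq> range ?g" "y \<in> U" "u y \<noteq> 0"
    "(\<Sum>w\<in>U. u w *\<^sub>C w) = 0"
    unfolding cvec.dependent_explicit by blast
  obtain A where A: "U = ?g ` A" using U(2) by (auto simp: subset_image_iff)
  have inj: "inj_on ?g A" using True by (rule inj_on_subset) simp
  have finA: "finite A" using U(1) finite_imageD[OF _ inj] by (simp add: A)
  obtain n where n: "n \<in> A" "y = ?g n" using U(3) A by auto
  \<comment> \<open>By injectivity each vector of the relation belongs to exactly one exponent, so
    its coefficient becomes the coefficient of that power.\<close>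
  define p where "p = (\<Sum>i\<in>A. monom (u (?g i)) i)"
  have "coeff p n = u (?g n)"
    using n(1) finA by (simp add: p_def coeff_sum)
  then have "p \<noteq> 0" using U(4) n by auto
  moreover have "poly_act T v p = (\<Sum>w\<in>U. u w *\<^sub>C w)"
    by (simp add: p_def poly_act_sum[OF assms(2)] poly_act_monom[OF assms(2)] A
        sum.reindex[OF inj])
  ultimately show ?thesis using U(5) that by simp
qed

text \<open>Among the nonzero polynomials killing \<open>v\<close>, one of least degree has a root
  \<open>c\<close>. Removing the factor \<open>t - c\<close> leaves \<open>q\<close> with
  \<open>q(T) v\<close> nonzero by minimality, and \<open>T - c\<close> kills this vector.\<close>

lemma ex_eigenvector:
  fixes T :: "'v::complex_vector \<Rightarrow> 'v"
  assumes "finite_dimensional TYPE('v)" "clinear T" "\<exists>v::'v. v \<noteq> 0"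
  obtains u c where "u \<noteq> 0" "T u = c *\<^sub>C u"
proof -
  obtain v :: 'v where v: "v \<noteq> 0" using assms(3) by blast
  let ?P = "\<lambda>p. p \<noteq> 0 \<and> poly_act T v p = 0"
  obtain p0 where "?P p0" using ex_annihilating_poly[OF assms(1,2)] by blast
  then obtain p where p: "?P p" and min: "\<And>q. ?P q \<Longrightarrow> degree p \<le> degree q"
    using ex_has_least_nat[of ?P p0 degree] by blast
  have "degree p \<noteq> 0"
  proof
    assume "degree p = 0"
    then obtain a where "p = [:a:]" using degree_eq_zeroE by blast
    then show False using p v by (simp add: poly_act_pCons[OF assms(2)] clinear_0[OF assms(2)])
  qed
  then have "\<not> constant (poly p)" by (simp add: constant_degree)
  then obtain c where "poly p c = 0" using fundamental_theorem_of_algebra by blast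
  then obtain q where q: "p = [:-c, 1:] * q" by (auto simp: poly_eq_0_iff_dvd)
  have "q \<noteq> 0" using p q by auto
  then have "degree q < degree p" unfolding q by (subst degree_mult_eq) auto
  then have u: "poly_act T v q \<noteq> 0" using min[of q] \<open>q \<noteq> 0\<close> by auto
  \<comment> \<open>Multiplication by \<open>t\<close> is \<open>pCons 0\<close>, which
    \<open>poly_act\<close> turns into an application of \<open>T\<close>.\<close>
  have "p = pCons 0 q + smult (- c) q" by (simp add: q)
  then have "T (poly_act T v q) - c *\<^sub>C poly_act T v q = 0"
    using p by (simp add: poly_act_add[OF assms(2)] poly_act_pCons[OF assms(2)]
        poly_act_smult[OF assms(2)] del: smult_minus_left)
  then show ?thesis using that[OF u, of c] by simp
qed

text \<open>An eigenspace of an operator commuting with the action is a submodule; being nonzero, it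
  is everything.\<close>

lemma schur:
  fixes \<rho> :: "'l::lie_algebra \<Rightarrow> 'v::complex_vector \<Rightarrow> 'v"
  assumes "finite_dimensional TYPE('v)" "irreducible_rep \<rho>" "clinear T"
    and comm: "\<And>x v. T (\<rho> x v) = \<rho> x (T v)"
  obtains c where "\<And>v. T v = c *\<^sub>C v"
proof -
  have rep: "cbilinear \<rho>"
    using assms(2) by (auto simp: irreducible_rep_def lie_rep_def)
  obtain u c where u: "u \<noteq> 0" "T u = c *\<^sub>C u"
    using ex_eigenvector[OF assms(1,3)] assms(2) by (auto simp: irreducible_rep_def)
  let ?W = "{v. T v = c *\<^sub>C v}"
  have "csubspace ?W"
    by (rule cvec.subspaceI) (simp_all add: clinear_0[OF assms(3)] clinear_add[OF assms(3)]
        clinear_scale[OF assms(3)] scaleC_add_right scaleC_scaleC scaleC_0_right mult.commute)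
  then have "submodule \<rho> ?W"
    by (simp add: submodule_def comm cbilinearD[OF rep])
  then have "?W = UNIV" using u assms(2) unfolding irreducible_rep_def by blast
  then show ?thesis using that by blast
qed


subsection \<open>Dual bases and the Casimir element\<close>

text \<open>The tensor product is the restriction of an evaluation module along
  \<open>x \<mapsto> x \<otimes> 1\<close>. Any evaluation points serve, since the polynomial 1 has
  value 1 everywhere.\<close>

lemma lie_rep_tensor_rep:
  assumes "lie_rep \<rho>" "lie_rep \<sigma>"
  shows "lie_rep (tensor_rep \<rho> \<sigma>)"
proof -
  let ?\<tau> = "evaluation_rep 0 0 \<rho> \<sigma>"
  have rep: "lie_rep ?\<tau>" by (rule lie_rep_evaluation_rep[OF assms])
  have bracket: "bracket x y \<otimes> (1 :: complex poly) = bracket (x \<otimes> 1) (y \<otimes> 1)" for x y :: 'a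
    by (simp add: bracket_tensor_tensor)
  have "cbilinear (\<lambda>x. ?\<tau> (x \<otimes> 1))"
    by (rule cbilinearI)
      (simp_all add: tensor_add_left tensor_scale_left cbilinearD[OF lie_repD(1)[OF rep]])
  then show ?thesis
    unfolding lie_rep_def evaluation_rep_one[OF assms, of 0 0, symmetric] bracket
    by (simp add: lie_repD(2)[OF rep] evaluation_rep_one[OF assms])
qed

lemma cbilinear_sum:
  assumes "cbilinear G"
  shows "G (\<Sum>i\<in>A. f i) y = (\<Sum>i\<in>A. G (f i) y)" "G x (\<Sum>j\<in>C. g j) = (\<Sum>j\<in>C. G x (g j))"
  using assms clinear_sum[of "\<lambda>x. G x y"] clinear_sum[of "G x"] by (auto simp: cbilinear_def)

section \<open>Invariant forms and dual bases\<close>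

locale nondegenerate_invariant_form =
  fixes B :: "'g::lie_algebra \<Rightarrow> 'g \<Rightarrow> complex" and E :: "'g set"
  assumes fin_dim: "finite_dimensional TYPE('g)"
    and bilinear: "cbilinear B" and invariant: "invariant_form B"
    and symmetric: "symmetric_form B" and nondegenerate: "nondegenerate_form B"
    and basis: "cbasis E"
begin

abbreviation dual :: "'g \<Rightarrow> 'g" where "dual \<equiv> dual_vector B E"

lemma finite_basis: "finite E"
proof -
  obtain S :: "'g set" where "finite S" "cspan S = UNIV"
    using fin_dim by (auto simp: finite_dimensional_def)
  then show ?thesis
    using cvec.independent_span_bound[of S E] basis by (auto simp: cbasis_def)
qed

lemma form_sym: "B x y = B y x"
  using symmetric by (simp add: symmetric_form_def)

lemmas form_simps = cbilinearD[OF bilinear, unfolded scaleC_complex_def]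

lemma form_sum_left: "B (\<Sum>i\<in>A. f i) y = (\<Sum>i\<in>A. B (f i) y)"
  by (induction A rule: infinite_finite_induct) (simp_all add: form_simps)

lemma form_sum_right: "B y (\<Sum>i\<in>A. f i) = (\<Sum>i\<in>A. B y (f i))"
  by (induction A rule: infinite_finite_induct) (simp_all add: form_simps)

lemma form_diff_right: "B y (a - b) = B y a - B y b"
  using form_simps(3)[of y "a - b" b] by simp

lemma orthogonal_to_basis_imp_zero:
  assumes "\<And>e. e \<in> E \<Longrightarrow> B e x = 0"
  shows "x = 0"
proof -
  have "clinear (\<lambda>y. B y x)" using bilinear by (simp add: cbilinear_def)
  then have "B y x = 0" for y
    by (rule clinear_span_zero[where S = E]) (use assms basis in \<open>auto simp: cbasis_def\<close>)
  then show ?thesis using nondegenerate by (simp add: nondegenerate_form_def form_sym[of x])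
qed

text \<open>Nondegeneracy makes this linear endomorphism injective, hence surjective in finite
  dimension. Thus the values of the form against the basis can be prescribed freely, which yields
  dual vectors.\<close>

lemma surj_basis_pairing: "surj (\<lambda>x. \<Sum>e\<in>E. B e x *\<^sub>C e)"
proof -
  interpret fd: finite_dimensional_vector_space "scaleC :: complex \<Rightarrow> 'g \<Rightarrow> 'g" E
    by unfold_locales (use basis finite_basis in \<open>auto simp: cbasis_def cdependent_def cspan_def\<close>)
  let ?\<phi> = "\<lambda>x. \<Sum>e\<in>E. B e x *\<^sub>C e"
  have lin: "clinear ?\<phi>"
    by (rule clinearI) (simp_all add: form_simps scaleC_add_left sum.distrib
        cvec.scale_sum_right scaleC_scaleC)
  have "x = y" if "?\<phi> x = ?\<phi> y" for x y
  proof -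
    have "(\<Sum>e\<in>E. B e (x - y) *\<^sub>C e) = 0"
      using that clinear_diff[OF lin, of x y] by simp
    then have "B e (x - y) = 0" if "e \<in> E" for e
      using cvec.independentD[OF _ finite_basis subset_refl _ that, of "\<lambda>e. B e (x - y)"] basis
      by (simp add: cbasis_def)
    then show ?thesis using orthogonal_to_basis_imp_zero[of "x - y"] by simp
  qed
  then have "inj ?\<phi>" by (auto intro: injI)
  then show ?thesis using fd.linear_inj_imp_surj[OF lin] by blast
qed

text \<open>Existence and uniqueness of the dual basis, which give the \<open>THE\<close> in
  \<open>dual_vector\<close> its meaning.\<close>

lemma form_dual_vector:
  assumes "e \<in> E" "e' \<in> E"
  shows "B e' (dual e) = (if e' = e then 1 else 0)"
proof -
  \<comment> \<open>The dual vector is the preimage of \<open>e\<close> under the pairing map;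
    comparing coefficients in the basis gives the Kronecker delta.\<close>
  obtain f where f: "e = (\<Sum>a\<in>E. B a f *\<^sub>C a)"
    using surj_basis_pairing by (blast elim: surjE)
  let ?u = "\<lambda>a. B a f - (if a = e then 1 else 0)"
  have "(\<Sum>a\<in>E. ?u a *\<^sub>C a) = (\<Sum>a\<in>E. B a f *\<^sub>C a) - (\<Sum>a\<in>E. if a = e then a else 0)"
    by (simp add: cvec.scale_left_diff_distrib sum_subtractf if_distribR if_distrib[of "\<lambda>c. c *\<^sub>C _"] cong: if_cong)
  also have "\<dots> = 0" using f[symmetric] assms(1) finite_basis by simp
  finally have "?u a = 0" if "a \<in> E" for a
    using cvec.independentD[OF _ finite_basis subset_refl _ that, of ?u] basis
    by (simp add: cbasis_def)
  then have "\<forall>e'\<in>E. B e' f = (if e' = e then 1 else 0)" by simp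
  moreover have "g = f" if "\<forall>e'\<in>E. B e' g = (if e' = e then 1 else 0)" for g
    using orthogonal_to_basis_imp_zero[of "g - f"] that calculation
    by (simp add: form_diff_right)
  ultimately have "\<forall>e'\<in>E. B e' (dual e) = (if e' = e then 1 else 0)"
    unfolding dual_vector_def by (rule theI)
  then show ?thesis using assms(2) by blast
qed

lemma sum_form_dual:
  "e \<in> E \<Longrightarrow> (\<Sum>a\<in>E. c a * B a (dual e)) = c e"
  "e \<in> E \<Longrightarrow> (\<Sum>a\<in>E. c a * B e (dual a)) = c e"
  using finite_basis by (simp_all add: form_dual_vector if_distrib cong: if_cong)

lemma basis_expansion: "y = (\<Sum>e\<in>E. B y (dual e) *\<^sub>C e)"
proof -
  obtain x where x: "y = (\<Sum>a\<in>E. B a x *\<^sub>C a)"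
    using surj_basis_pairing by (blast elim: surjE)
  have "B y (dual e) = B e x" if "e \<in> E" for e
    using that by (simp add: x form_sum_left form_simps sum_form_dual)
  then show ?thesis using x by simp
qed

lemma dual_basis_expansion: "y = (\<Sum>e\<in>E. B y e *\<^sub>C dual e)"
proof -
  have "y - (\<Sum>e\<in>E. B y e *\<^sub>C dual e) = 0"
    by (rule orthogonal_to_basis_imp_zero)
      (simp add: form_diff_right form_sum_right form_simps sum_form_dual form_sym)
  then show ?thesis by simp
qed

text \<open>Symmetry of the Casimir element, tested against an arbitrary bilinear map: the Gram
  matrix of the dual basis is symmetric.\<close>

lemma casimir_sum_sym:
  assumes "cbilinear G"
  shows "(\<Sum>e\<in>E. G (dual e) e) = (\<Sum>e\<in>E. G e (dual e))"
proof -
  note lin = cbilinear_sum[OF assms] cbilinearD[OF assms]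
  have "(\<Sum>e\<in>E. G (dual e) e) = (\<Sum>e\<in>E. \<Sum>a\<in>E. B (dual e) (dual a) *\<^sub>C G a e)"
    by (subst basis_expansion[of "dual _"]) (simp add: lin)
  also have "\<dots> = (\<Sum>a\<in>E. \<Sum>e\<in>E. B (dual a) (dual e) *\<^sub>C G a e)"
    by (subst sum.swap) (simp add: form_sym)
  also have "\<dots> = (\<Sum>a\<in>E. G a (dual a))"
    \<comment> \<open>The index skips the two dual vectors inside \<open>B\<close> and expands the
      one inside \<open>G\<close>.\<close>
    by (subst (3) basis_expansion[of "dual _"]) (simp add: lin)
  finally show ?thesis .
qed

text \<open>The Casimir element is killed by the adjoint action. Since \<open>bracket x\<close> is
  skew for \<open>B\<close>, its matrix in the dual basis is minus the transpose of its matrix in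
  \<open>E\<close>, and the expanded sums cancel.\<close>

lemma casimir_sum_invariant:
  assumes "cbilinear G"
  shows "(\<Sum>e\<in>E. G (bracket x e) (dual e)) + (\<Sum>e\<in>E. G e (bracket x (dual e))) = 0"
proof -
  note lin = cbilinear_sum[OF assms] cbilinearD[OF assms]
  have form: "B (bracket x (dual a)) e = - B (bracket x e) (dual a)" for a e
  proof -
    have "B (bracket x (dual a)) e + B (bracket (dual a) x) e = 0"
      by (simp add: bracket_skew[of x] form_simps flip: form_simps(1))
    moreover have "B (bracket (dual a) x) e = B (bracket x e) (dual a)"
      using invariant by (simp add: invariant_form_def form_sym[of "dual a"])
    ultimately show ?thesis by (simp add: eq_neg_iff_add_eq_0)
  qed
  have "(\<Sum>e\<in>E. G (bracket x e) (dual e))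
      = (\<Sum>e\<in>E. \<Sum>a\<in>E. B (bracket x e) (dual a) *\<^sub>C G a (dual e))"
    by (subst basis_expansion[of "bracket x _"]) (simp add: lin)
  also have "\<dots> = (\<Sum>a\<in>E. \<Sum>e\<in>E. B (bracket x e) (dual a) *\<^sub>C G a (dual e))"
    by (rule sum.swap)
  finally have 1: "(\<Sum>e\<in>E. G (bracket x e) (dual e))
      = (\<Sum>a\<in>E. \<Sum>e\<in>E. B (bracket x e) (dual a) *\<^sub>C G a (dual e))" .
  have "(\<Sum>e\<in>E. G e (bracket x (dual e)))
      = (\<Sum>a\<in>E. \<Sum>e\<in>E. B (bracket x (dual a)) e *\<^sub>C G a (dual e))"
    by (subst dual_basis_expansion[of "bracket x _"]) (simp add: lin)
  then show ?thesis unfolding 1 form by (simp add: sum_negf)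
qed

section \<open>Casimir operators on representations\<close>

abbreviation casimir_act :: "('g \<Rightarrow> 'v::complex_vector \<Rightarrow> 'v) \<Rightarrow> 'v \<Rightarrow> 'v"
  where "casimir_act \<rho> v \<equiv> tensor_square_act \<rho> (casimir B E) v"

lemma clinear_casimir_act:
  assumes "lie_rep \<rho>"
  shows "clinear (casimir_act \<rho>)"
  by (rule clinearI) (simp_all add: tensor_square_act_casimir[OF assms] sum.distrib
      cbilinearD[OF lie_repD(1)[OF assms]] cvec.scale_sum_right)

text \<open>Invariance is applied to \<open>G a b = \<rho> a (\<rho> b v)\<close>. When the brackets
  are expanded into commutators, the terms with \<open>\<rho> x\<close> in the middle cancel,
  leaving the commutator of \<open>\<rho> x\<close> with the Casimir operator.\<close>

lemma casimir_act_commute: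
  assumes "lie_rep \<rho>"
  shows "casimir_act \<rho> (\<rho> x v) = \<rho> x (casimir_act \<rho> v)"
proof -
  note lin = cbilinearD[OF lie_repD(1)[OF assms]]
  have diff: "\<rho> y (a - b) = \<rho> y a - \<rho> y b" for y a b
    using lin(3)[of y "a - b" b] by simp
  have "cbilinear (\<lambda>a b. \<rho> a (\<rho> b v))"
    by (rule cbilinearI) (simp_all add: lin)
  from casimir_sum_invariant[OF this, of x]
  have "(\<Sum>e\<in>E. \<rho> x (\<rho> e (\<rho> (dual e) v))) - (\<Sum>e\<in>E. \<rho> e (\<rho> (dual e) (\<rho> x v))) = 0"
    by (simp add: lie_repD(2)[OF assms] diff sum_subtractf)
  then show ?thesis
    by (simp add: tensor_square_act_casimir[OF assms] cbilinear_sum[OF lie_repD(1)[OF assms]])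
qed

lemma casimir_act_irreducible:
  fixes \<rho> :: "'g \<Rightarrow> 'v::complex_vector \<Rightarrow> 'v"
  assumes "finite_dimensional TYPE('v)" "irreducible_rep \<rho>"
  shows "casimir_act \<rho> v = casimir_scalar B E \<rho> *\<^sub>C v"
proof -
  have rep: "lie_rep \<rho>" using assms(2) by (simp add: irreducible_rep_def)
  obtain w :: 'v where w: "w \<noteq> 0" using assms(2) by (auto simp: irreducible_rep_def)
  obtain c where c: "\<And>v. casimir_act \<rho> v = c *\<^sub>C v"
    using schur[OF assms clinear_casimir_act[OF rep]] casimir_act_commute[OF rep] by blast
  \<comment> \<open>The nonzero vector \<open>w\<close> makes the scalar unique.\<close>
  have "casimir_scalar B E \<rho> = c"
    unfolding casimir_scalar_def c using w by auto
  then show ?thesis by (simp add: c)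
qed

text \<open>Intertwiners carry the Casimir action along, so each copy of \<open>\<rho>\<close> has
  the same scalar; linearity extends this to the span of the copies.\<close>

lemma casimir_act_isotypic:
  fixes \<rho> :: "'g \<Rightarrow> 'v::complex_vector \<Rightarrow> 'v" and \<sigma> :: "'g \<Rightarrow> 'w::complex_vector \<Rightarrow> 'w"
  assumes "finite_dimensional TYPE('v)" "irreducible_rep \<rho>" "lie_rep \<sigma>"
    and "w \<in> isotypic_component \<rho> \<sigma>"
  shows "casimir_act \<sigma> w = casimir_scalar B E \<rho> *\<^sub>C w"
proof -
  let ?c = "casimir_scalar B E \<rho>"
  have rep: "lie_rep \<rho>" using assms(2) by (simp add: irreducible_rep_def)
  note lin = clinear_casimir_act[OF assms(3)]
  have lin': "clinear (\<lambda>w. casimir_act \<sigma> w - ?c *\<^sub>C w)"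
    by (rule clinearI) (simp_all add: clinear_add[OF lin] clinear_scale[OF lin] scaleC_add_right
        scaleC_scaleC cvec.scale_right_diff_distrib mult.commute)
  have "casimir_act \<sigma> (f v) - ?c *\<^sub>C f v = 0"
    if "clinear f" "\<And>x v. f (\<rho> x v) = \<sigma> x (f v)" for f :: "'v \<Rightarrow> 'w" and v
  proof -
    have "casimir_act \<sigma> (f v) = f (casimir_act \<rho> v)"
      by (simp add: tensor_square_act_casimir[OF rep] tensor_square_act_casimir[OF assms(3)]
          clinear_sum[OF that(1)] that(2))
    then show ?thesis by (simp add: casimir_act_irreducible[OF assms(1,2)] clinear_scale[OF that(1)])
  qed
  then have "casimir_act \<sigma> w - ?c *\<^sub>C w = 0"
    by (intro clinear_span_zero[OF lin' _ assms(4)[unfolded isotypic_component_def]])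
      (auto simp: bij_betw_def)
  then show ?thesis by simp
qed


subsection \<open>The action on evaluation modules\<close>

lemma uea_act_casimir_poly:
  assumes "lie_rep \<tau>"
  shows "uea_act \<tau> (casimir_poly B E P Q) v = (\<Sum>e\<in>E. \<tau> (e \<otimes> P) (\<tau> (dual e \<otimes> Q) v))"
  by (simp add: casimir_poly_def clinear_sum[OF clinear_uea_act[OF assms]] uea_act_mult[OF assms]
      uea_act_uea_of[OF assms])

text \<open>Each product of two actions gives four terms. Those acting twice on one factor sum to
  Casimir operators; the two mixed sums differ by exchanging \<open>e\<close> and
  \<open>dual e\<close>, so symmetry merges them.\<close>

lemma casimir_poly_evaluation_tensor:
  assumes "lie_rep \<rho>" "lie_rep \<sigma>"
  shows "uea_act (evaluation_rep p1 p2 \<rho> \<sigma>) (casimir_poly B E P Q) (v \<otimes> w) =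
    (poly P p1 * poly Q p1) *\<^sub>C (casimir_act \<rho> v \<otimes> w) +
    (poly P p2 * poly Q p2) *\<^sub>C (v \<otimes> casimir_act \<sigma> w) +
    (poly P p1 * poly Q p2 + poly P p2 * poly Q p1) *\<^sub>C (\<Sum>e\<in>E. \<rho> e v \<otimes> \<sigma> (dual e) w)"
proof -
  let ?\<tau> = "evaluation_rep p1 p2 \<rho> \<sigma>"
  have rep: "lie_rep ?\<tau>" by (rule lie_rep_evaluation_rep[OF assms])
  have "cbilinear (\<lambda>a b. \<rho> a v \<otimes> \<sigma> b w)"
    by (rule cbilinearI) (simp_all add: cbilinearD[OF lie_repD(1)[OF assms(1)]]
        cbilinearD[OF lie_repD(1)[OF assms(2)]] cbilinearD[OF cbilinear_tensor])
  from casimir_sum_sym[OF this]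
  have sym: "(\<Sum>e\<in>E. \<rho> (dual e) v \<otimes> \<sigma> e w) = (\<Sum>e\<in>E. \<rho> e v \<otimes> \<sigma> (dual e) w)" .
  show ?thesis
    by (simp add: uea_act_casimir_poly[OF rep] evaluation_rep_tensor[OF assms]
        cbilinearD[OF lie_repD(1)[OF rep]] tensor_square_act_casimir[OF assms(1)]
        tensor_square_act_casimir[OF assms(2)] cbilinear_sum[OF cbilinear_tensor]
        scaleC_add_right scaleC_scaleC sum.distrib scaleC_add_left sym mult.commute add_ac
        flip: cvec.scale_sum_right)
qed

text \<open>This makes the ordinary Casimir action the case \<open>P = Q = 1\<close> of the
  evaluation formula.\<close>

lemma casimir_act_tensor_rep:
  assumes "lie_rep \<rho>" "lie_rep \<sigma>"
  shows "casimir_act (tensor_rep \<rho> \<sigma>) t = uea_act (evaluation_rep 0 0 \<rho> \<sigma>) (casimir_poly B E 1 1) t"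
  using lie_rep_tensor_rep[OF assms]
  by (simp add: tensor_square_act_casimir uea_act_casimir_poly[OF lie_rep_evaluation_rep[OF assms]]
      evaluation_rep_one[OF assms])

text \<open>The Casimir action on the tensor product is kept as an operator here, so that both sides
  are additive in \<open>t\<close> and pure tensors suffice. It becomes a scalar only on an isotypic
  component.\<close>

lemma casimir_poly_evaluation:
  assumes "lie_rep \<rho>" "lie_rep \<sigma>"
    and c: "\<And>v. casimir_act \<rho> v = c *\<^sub>C v" and d: "\<And>w. casimir_act \<sigma> w = d *\<^sub>C w"
  shows "uea_act (evaluation_rep p1 p2 \<rho> \<sigma>) (casimir_poly B E P Q) t =
    (poly P p1 * poly Q p1 * c + poly P p2 * poly Q p2 * d) *\<^sub>C t +
    ((poly P p1 * poly Q p2 + poly P p2 * poly Q p1) / 2) *\<^sub>C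
      (casimir_act (tensor_rep \<rho> \<sigma>) t - (c + d) *\<^sub>C t)"
proof (induction t rule: tensor_induct)
  case (tensor v w)
  \<comment> \<open>With \<open>P = Q = 1\<close> the mixed coefficient is \<open>1 + 1\<close>, the
    source of the division by 2.\<close>
  have "casimir_act (tensor_rep \<rho> \<sigma>) (v \<otimes> w) - (c + d) *\<^sub>C (v \<otimes> w) =
    2 *\<^sub>C (\<Sum>e\<in>E. \<rho> e v \<otimes> \<sigma> (dual e) w)"
    by (simp add: casimir_act_tensor_rep[OF assms(1,2)] casimir_poly_evaluation_tensor[OF assms(1,2)]
        c d tensor_scale_left tensor_scale_right scaleC_add_left)
  then show ?case
    by (simp add: casimir_poly_evaluation_tensor[OF assms(1,2)] c d tensor_scale_left
        tensor_scale_right scaleC_add_left scaleC_scaleC add_divide_distrib)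
next
  case (add s t)
  have rep: "lie_rep (evaluation_rep p1 p2 \<rho> \<sigma>)" by (rule lie_rep_evaluation_rep[OF assms(1,2)])
  have "uea_act (evaluation_rep p1 p2 \<rho> \<sigma>) (casimir_poly B E P Q) (s + t) =
    uea_act (evaluation_rep p1 p2 \<rho> \<sigma>) (casimir_poly B E P Q) s +
    uea_act (evaluation_rep p1 p2 \<rho> \<sigma>) (casimir_poly B E P Q) t"
    by (simp add: uea_act_casimir_poly[OF rep] cbilinearD[OF lie_repD(1)[OF rep]] sum.distrib)
  then show ?case
    unfolding add
    by (simp add: clinear_add[OF clinear_casimir_act[OF lie_rep_tensor_rep[OF assms(1,2)]]]
        scaleC_add_right algebra_simps)
qed

end

theorem lemma6:
  fixes B :: "'g::lie_algebra \<Rightarrow> 'g \<Rightarrow> complex"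
    and E H :: "'g set"
    and Pos :: "('g \<Rightarrow> complex) set"
    and lam1 lam2 \<mu> :: "'g \<Rightarrow> complex"
    and \<rho>1 :: "'g \<Rightarrow> 'v1::complex_vector \<Rightarrow> 'v1"
    and \<rho>2 :: "'g \<Rightarrow> 'v2::complex_vector \<Rightarrow> 'v2"
    and \<rho>\<mu> :: "'g \<Rightarrow> 'm::complex_vector \<Rightarrow> 'm"
    and p1 p2 w1 w2 z1 z2 :: complex
    and P Q :: "complex poly"
    and v :: "('v1, 'v2) tensor"
  assumes "finite_dimensional TYPE('g)" and "reductive TYPE('g)"
    and "cbilinear B" and "invariant_form B" and "symmetric_form B" and "nondegenerate_form B"
    and "cbasis E"
    and "cartan_subalgebra H" and "positive_system H Pos"
    and "dominant_integral H Pos lam1" and "dominant_integral H Pos lam2"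
    and "irreducible_highest_weight_rep H Pos lam1 \<rho>1"
    and "irreducible_highest_weight_rep H Pos lam2 \<rho>2"
    and "irreducible_highest_weight_rep H Pos \<mu> \<rho>\<mu>"
    and "w1 = poly P p1" and "w2 = poly P p2" and "z1 = poly Q p1" and "z2 = poly Q p2"
    and "v \<in> isotypic_component \<rho>\<mu> (tensor_rep \<rho>1 \<rho>2)"
  shows "uea_act (evaluation_rep p1 p2 \<rho>1 \<rho>2) (casimir_poly B E P Q) v =
    (w1 * z1 * casimir_scalar B E \<rho>1 + w2 * z2 * casimir_scalar B E \<rho>2 +
      (w1 * z2 + w2 * z1) / 2 *
        (casimir_scalar B E \<rho>\<mu> - casimir_scalar B E \<rho>1 - casimir_scalar B E \<rho>2)) *\<^sub>C v"
proof -
  interpret nondegenerate_invariant_form B E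
    using assms by unfold_locales
  have irr: "irreducible_rep \<rho>1" "irreducible_rep \<rho>2" "irreducible_rep \<rho>\<mu>"
    and fd: "finite_dimensional TYPE('v1)" "finite_dimensional TYPE('v2)" "finite_dimensional TYPE('m)"
    using assms(12-14) by (auto simp: irreducible_highest_weight_rep_def)
  then have rep: "lie_rep \<rho>1" "lie_rep \<rho>2"
    by (auto simp: irreducible_rep_def)
  have iso: "casimir_act (tensor_rep \<rho>1 \<rho>2) v = casimir_scalar B E \<rho>\<mu> *\<^sub>C v"
    using casimir_act_isotypic[OF fd(3) irr(3) lie_rep_tensor_rep[OF rep] assms(19)] .
  show ?thesis
    unfolding assms(15-18) casimir_poly_evaluation[OF rep casimir_act_irreducible[OF fd(1) irr(1)]
      casimir_act_irreducible[OF fd(2) irr(2)]] iso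
      cvec.scale_left_diff_distrib[symmetric] scaleC_scaleC scaleC_add_left[symmetric]
    \<comment> \<open>Both sides are now multiples of \<open>v\<close>, differing only in how the
      two scalars are subtracted from that of \<open>\<rho>\<mu>\<close>.\<close>
    by (simp only: diff_diff_eq)
qed

end
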